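(* Let $A$ be a rational function of degree $n\geq 2$ (over $\mathbb{C}$) that is not conjugate to $z^{n}$ or to $z^{-n}$. Then the group $\mathrm{Aut}_\infty(A)$ is finite and its order is bounded in terms of $n$ only. Moreover, every $\nu\in\mathrm{Aut}_\infty(A)$ maps the set $c(A)$ to the set $c(A^{\circ 2})$, that is, $\nu(c(A))\subseteq c(A^{\circ 2})$.
   Context: Rational functions are viewed as holomorphic maps $\mathbb{CP}^1\to\mathbb{CP}^1$, and $A^{\circ k}$ denotes the $k$-th iterate of $A$. "Conjugate" means conjugate by a Möbius transformation. For a rational function $F$ of degree at least two, $\mathrm{Aut}(F)$ is the group of Möbius transformations $\sigma$ with $F\circ\sigma=\sigma\circ F$, and $c(F)\subset\mathbb{CP}^1$ is the set of critical values of $F$. Define $\mathrm{Aut}_\infty(A)=\bigcup_{k=1}^\infty \mathrm{Aut}(A^{\circ k})$, which is a group. "Bounded in terms of $n$ only" means bounded by a number depending only on $n$. *)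

theory Defs
  imports Complex_Main "HOL-Computational_Algebra.Polynomial"
begin

text \<open>The Riemann sphere, i.e. the complex projective line with its affine coordinate \<open>z\<close>.\<close>

datatype cp1 = Fin complex | Infty

text \<open>The point with homogeneous coordinates \<open>[a : b]\<close>, for \<open>(a, b) \<noteq> (0, 0)\<close>.\<close>

definition hpoint :: "complex \<Rightarrow> complex \<Rightarrow> cp1" where
  "hpoint a b = (if b = 0 then Infty else Fin (a / b))"

text \<open>The map given by \<open>p / q\<close>. At infinity it is evaluated on the homogenisations of \<open>p\<close> and
  \<open>q\<close> in degree \<open>max (degree p) (degree q)\<close>, whose values at \<open>[1 : 0]\<close> are the coefficients
  in that degree. This is the intended map only for coprime \<open>p\<close> and \<open>q\<close>.\<close>

fun ratmap :: "complex poly \<Rightarrow> complex poly \<Rightarrow> cp1 \<Rightarrow> cp1" where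
  "ratmap p q (Fin z) = hpoint (poly p z) (poly q z)"
| "ratmap p q Infty =
     (let n = max (degree p) (degree q) in hpoint (coeff p n) (coeff q n))"

definition rational_of_degree :: "nat \<Rightarrow> (cp1 \<Rightarrow> cp1) \<Rightarrow> bool" where
  "rational_of_degree n F \<longleftrightarrow>
     (\<exists>p q. coprime p q \<and> max (degree p) (degree q) = n \<and> F = ratmap p q)"

fun moebius_map :: "complex \<Rightarrow> complex \<Rightarrow> complex \<Rightarrow> complex \<Rightarrow> cp1 \<Rightarrow> cp1" where
  "moebius_map a b c d (Fin z) = hpoint (a * z + b) (c * z + d)"
| "moebius_map a b c d Infty = hpoint a c"

definition moebius :: "(cp1 \<Rightarrow> cp1) \<Rightarrow> bool" where
  "moebius \<sigma> \<longleftrightarrow> (\<exists>a b c d. a * d - b * c \<noteq> 0 \<and> \<sigma> = moebius_map a b c d)"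

definition moebius_conjugate :: "(cp1 \<Rightarrow> cp1) \<Rightarrow> (cp1 \<Rightarrow> cp1) \<Rightarrow> bool" where
  "moebius_conjugate F G \<longleftrightarrow> (\<exists>\<mu>. moebius \<mu> \<and> F = inv \<mu> \<circ> G \<circ> \<mu>)"

definition Aut :: "(cp1 \<Rightarrow> cp1) \<Rightarrow> (cp1 \<Rightarrow> cp1) set" where
  "Aut F = {\<sigma>. moebius \<sigma> \<and> F \<circ> \<sigma> = \<sigma> \<circ> F}"

definition Aut_infty :: "(cp1 \<Rightarrow> cp1) \<Rightarrow> (cp1 \<Rightarrow> cp1) set" where
  "Aut_infty A = (\<Union>k\<in>{1..}. Aut (A ^^ k))"

text \<open>The two standard charts, \<open>z\<close> on the finite points and \<open>1 / z\<close> on the nonzero points, with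
  their inverses. The first argument only selects the chart: \<open>z\<close> if it is finite, \<open>1 / z\<close> if it
  is infinite. Each chart has a dummy value \<open>0\<close> at the single point outside its domain.\<close>

fun chart :: "cp1 \<Rightarrow> cp1 \<Rightarrow> complex" where
  "chart (Fin a) (Fin z) = z"
| "chart (Fin a) Infty = 0"
| "chart Infty (Fin z) = 1 / z"
| "chart Infty Infty = 0"

fun chart_inv :: "cp1 \<Rightarrow> complex \<Rightarrow> cp1" where
  "chart_inv (Fin a) t = Fin t"
| "chart_inv Infty t = hpoint 1 t"

definition critical_point :: "(cp1 \<Rightarrow> cp1) \<Rightarrow> cp1 \<Rightarrow> bool" where
  "critical_point F x \<longleftrightarrow>
     ((chart (F x) \<circ> F \<circ> chart_inv x) has_field_derivative 0) (at (chart x x))"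

definition critical_values :: "(cp1 \<Rightarrow> cp1) \<Rightarrow> cp1 set" where
  "critical_values F = F ` {x. critical_point F x}"


text \<open>\<^const>\<open>Aut_infty\<close> is a group under composition.\<close>

lemma moebius_map_hpoint:
  assumes "u \<noteq> 0 \<or> v \<noteq> 0"
  shows "moebius_map a b c d (hpoint u v) = hpoint (a * u + b * v) (c * u + d * v)"
proof (cases "v = 0")
  case True
  then show ?thesis using assms by (simp add: hpoint_def)
next
  case False
  have "a * (u / v) + b = (a * u + b * v) / v" "c * (u / v) + d = (c * u + d * v) / v"
    using False by (simp_all add: field_simps)
  then show ?thesis using False by (simp add: hpoint_def)
qed

lemma moebius_map_comp:
  assumes "a' * d' - b' * c' \<noteq> 0"
  shows "moebius_map a b c d \<circ> moebius_map a' b' c' d' =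
    moebius_map (a * a' + b * c') (a * b' + b * d') (c * a' + d * c') (c * b' + d * d')"
proof
  fix x
  show "(moebius_map a b c d \<circ> moebius_map a' b' c' d') x =
    moebius_map (a * a' + b * c') (a * b' + b * d') (c * a' + d * c') (c * b' + d * d') x"
  proof (cases x)
    case (Fin z)
    have "a' * z + b' \<noteq> 0 \<or> c' * z + d' \<noteq> 0"
    proof (rule ccontr)
      assume "\<not> ?thesis"
      then have "a' * z + b' = 0" "c' * z + d' = 0" by auto
      then have "b' = - (a' * z)" "d' = - (c' * z)" by (simp_all add: eq_neg_iff_add_eq_0 add.commute)
      then show False using assms by simp
    qed
    then show ?thesis using Fin by (simp add: moebius_map_hpoint algebra_simps)
  next
    case Infty
    have "a' \<noteq> 0 \<or> c' \<noteq> 0" using assms by auto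
    then show ?thesis using Infty by (simp add: moebius_map_hpoint)
  qed
qed

lemma moebius_map_scalar: "e \<noteq> 0 \<Longrightarrow> moebius_map e 0 0 e = id"
proof
  fix x assume "e \<noteq> 0"
  then show "moebius_map e 0 0 e x = id x" by (cases x) (auto simp: hpoint_def)
qed

lemma moebius_id: "moebius id"
  unfolding moebius_def using moebius_map_scalar[of 1]
  by (intro exI[of _ 1] exI[of _ 0]) auto

lemma moebius_comp:
  assumes "moebius \<sigma>" "moebius \<tau>"
  shows "moebius (\<sigma> \<circ> \<tau>)"
proof -
  obtain a b c d where s: "a * d - b * c \<noteq> 0" "\<sigma> = moebius_map a b c d"
    using assms(1) moebius_def by auto
  obtain a' b' c' d' where t: "a' * d' - b' * c' \<noteq> 0" "\<tau> = moebius_map a' b' c' d'"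
    using assms(2) moebius_def by auto
  have "(a * a' + b * c') * (c * b' + d * d') - (a * b' + b * d') * (c * a' + d * c') =
      (a * d - b * c) * (a' * d' - b' * c')" by algebra
  then have "(a * a' + b * c') * (c * b' + d * d') - (a * b' + b * d') * (c * a' + d * c') \<noteq> 0"
    using s(1) t(1) by simp
  then show ?thesis
    unfolding moebius_def using moebius_map_comp[OF t(1)] s(2) t(2) by blast
qed

lemma moebius_inverse:
  assumes "moebius \<sigma>"
  shows "bij \<sigma> \<and> moebius (inv \<sigma>)"
proof -
  obtain a b c d where s: "a * d - b * c \<noteq> 0" "\<sigma> = moebius_map a b c d"
    using assms moebius_def by auto
  let ?t = "moebius_map d (- b) (- c) a"
  have s': "d * a - (- b) * (- c) \<noteq> 0" using s(1) by (simp add: algebra_simps)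
  have 1: "\<sigma> \<circ> ?t = id"
    using moebius_map_comp[OF s', of a b c d] moebius_map_scalar[OF s(1)] s(2)
    by (simp add: algebra_simps)
  have 2: "?t \<circ> \<sigma> = id"
    using moebius_map_comp[OF s(1), of d "- b" "- c" a] moebius_map_scalar[OF s(1)] s(2)
    by (simp add: algebra_simps)
  have "inv \<sigma> = ?t" using 1 2 by (rule inv_unique_comp)
  moreover have "moebius ?t" using s' moebius_def by blast
  ultimately show ?thesis using 1 2 o_bij by auto
qed

lemma Aut_iterate: "\<sigma> \<in> Aut F \<Longrightarrow> \<sigma> \<in> Aut (F ^^ k)"
proof (induction k)
  case 0
  then show ?case by (simp add: Aut_def fun_eq_iff)
next
  case (Suc k)
  then have "F \<circ> \<sigma> = \<sigma> \<circ> F" "(F ^^ k) \<circ> \<sigma> = \<sigma> \<circ> (F ^^ k)" "moebius \<sigma>" by (auto simp: Aut_def)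
  then show ?case by (simp add: Aut_def fun_eq_iff)
qed

lemma Aut_infty_id: "id \<in> Aut_infty A"
  unfolding Aut_infty_def Aut_def using moebius_id by auto

lemma Aut_infty_comp:
  assumes "\<sigma> \<in> Aut_infty A" "\<tau> \<in> Aut_infty A"
  shows "\<sigma> \<circ> \<tau> \<in> Aut_infty A"
proof -
  obtain k l where k: "k \<ge> 1" "\<sigma> \<in> Aut (A ^^ k)" and l: "l \<ge> 1" "\<tau> \<in> Aut (A ^^ l)"
    using assms unfolding Aut_infty_def by auto
  have "\<sigma> \<in> Aut (A ^^ (k * l))" "\<tau> \<in> Aut (A ^^ (k * l))"
    using Aut_iterate[OF k(2), of l] Aut_iterate[OF l(2), of k]
    by (simp_all add: funpow_mult mult.commute)
  then have "\<sigma> \<circ> \<tau> \<in> Aut (A ^^ (k * l))"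
    unfolding Aut_def by (auto simp: moebius_comp fun_eq_iff)
  moreover have "k * l \<ge> 1" using k l by simp
  ultimately show ?thesis unfolding Aut_infty_def by blast
qed

lemma Aut_infty_inv:
  assumes "\<sigma> \<in> Aut_infty A"
  shows "inv \<sigma> \<in> Aut_infty A"
proof -
  obtain k where k: "k \<ge> 1" "\<sigma> \<in> Aut (A ^^ k)" using assms unfolding Aut_infty_def by auto
  then have m: "moebius \<sigma>" and c: "\<And>x. (A ^^ k) (\<sigma> x) = \<sigma> ((A ^^ k) x)"
    by (auto simp: Aut_def fun_eq_iff)
  have b: "bij \<sigma>" "moebius (inv \<sigma>)" using moebius_inverse[OF m] by auto
  have "(A ^^ k) (inv \<sigma> x) = inv \<sigma> ((A ^^ k) x)" for x
    using b(1) c[of "inv \<sigma> x"] by (metis bij_inv_eq_iff)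
  then have "inv \<sigma> \<in> Aut (A ^^ k)" using b(2) by (auto simp: Aut_def fun_eq_iff)
  then show ?thesis using k(1) unfolding Aut_infty_def by blast
qed

end

theory Submission
  imports Defs "HOL-Computational_Algebra.Fundamental_Theorem_Algebra"
begin

text \<open>A point is a critical value of a rational function of degree \<open>n\<close> iff its fibre has fewer than
  \<open>n\<close> points, and by Riemann--Hurwitz the deficits of all fibres add up to \<open>2 n - 2\<close>. Let \<open>\<nu>\<close> commute
  with \<open>A\<^sup>k\<close>, where \<open>k \<ge> 2\<close>. Then \<open>A\<^sup>-\<^sup>k(x)\<close> and \<open>A\<^sup>-\<^sup>k(\<nu> x)\<close> have the same size. If \<open>x\<close> is a critical
  value of \<open>A\<close>, there are at most \<open>(n - 1) n\<^sup>k\<^sup>-\<^sup>1\<close> preimages. If \<open>\<nu> x\<close> were not a critical value of \<open>A\<^sup>2\<close>,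
  it would have \<open>n\<^sup>2\<close> preimages under \<open>A\<^sup>2\<close>, and, each further pullback losing at most \<open>2 n - 2\<close> points,
  at least \<open>n\<^sup>k - 2 n\<^sup>k\<^sup>-\<^sup>2 + 2\<close> under \<open>A\<^sup>k\<close>, which is more. Hence \<open>\<nu>\<close> maps \<open>c(A)\<close> into \<open>c(A\<^sup>2)\<close>.

  If \<open>c(A\<^sup>2)\<close> has only two points, these are also the critical values of \<open>A\<close>, and all fibres of \<open>A\<close>
  and \<open>A\<^sup>2\<close> over them are single points; then \<open>A\<close> fixes or swaps the two points and is conjugate to
  \<open>z\<^sup>n\<close> or \<open>z\<^sup>-\<^sup>n\<close>. Otherwise \<open>c(A\<^sup>2)\<close> has three points, whose images in \<open>c(A\<^sup>4)\<close> determine \<open>\<nu>\<close>.\<close>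

section \<open>Rational maps in homogeneous coordinates\<close>

lemma hpoint_cases:
  obtains u v where "x = hpoint u v" "u \<noteq> 0 \<or> v \<noteq> 0"
  by (cases x) (auto simp: hpoint_def, metis div_by_1 zero_neq_one, metis zero_neq_one)

lemma hpoint_eq_iff:
  assumes "u \<noteq> 0 \<or> v \<noteq> 0" "u' \<noteq> 0 \<or> v' \<noteq> 0"
  shows "hpoint u v = hpoint u' v' \<longleftrightarrow> u * v' = u' * v"
  using assms by (auto simp: hpoint_def field_simps)

lemma hpoint_scale: "c \<noteq> 0 \<Longrightarrow> hpoint (c * u) (c * v) = hpoint u v"
  by (auto simp: hpoint_def)

text \<open>Since n may exceed the degree of p, evaluation at (1, 0) gives the coefficient in degree
  n, possibly 0, as \<open>ratmap\<close> does at infinity. Infinity thus becomes an ordinary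
  point.\<close>

definition hom_eval :: "nat \<Rightarrow> complex poly \<Rightarrow> complex \<Rightarrow> complex \<Rightarrow> complex" where
  "hom_eval n p u v = (\<Sum>i\<le>n. coeff p i * u ^ i * v ^ (n - i))"

lemma hom_eval_nonzero:
  assumes "degree p \<le> n" "v \<noteq> 0"
  shows "hom_eval n p u v = v ^ n * poly p (u / v)"
proof -
  have "poly p (u / v) = (\<Sum>i\<le>n. coeff p i * (u / v) ^ i)"
    unfolding poly_altdef using assms(1)
    by (intro sum.mono_neutral_left) (auto simp: coeff_eq_0)
  then show ?thesis
    unfolding hom_eval_def sum_distrib_left
    by (simp add: sum_distrib_left, intro sum.cong)
      (use assms(2) in \<open>auto simp: power_divide field_simps simp flip: power_add\<close>)
qed

lemma hom_eval_zero: "hom_eval n p u 0 = coeff p n * u ^ n"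
proof -
  have "hom_eval n p u 0 = (\<Sum>i\<le>n. if i = n then coeff p i * u ^ i else 0)"
    unfolding hom_eval_def by (intro sum.cong) (auto simp: power_0_left)
  then show ?thesis by simp
qed

text \<open>By the fundamental theorem of algebra, a common divisor without roots is a nonzero
  constant.\<close>

lemma complex_coprime_iff_no_common_root:
  fixes p q :: "complex poly"
  shows "coprime p q \<longleftrightarrow> (\<forall>z. poly p z \<noteq> 0 \<or> poly q z \<noteq> 0)"
proof
  assume cop: "coprime p q"
  show "\<forall>z. poly p z \<noteq> 0 \<or> poly q z \<noteq> 0"
  proof (rule ccontr)
    assume "\<not> ?thesis"
    then obtain z where "[:-z, 1:] dvd p" "[:-z, 1:] dvd q"
      by (auto simp: poly_eq_0_iff_dvd)
    then have "is_unit [:-z, 1:]" using cop by (meson coprime_common_divisor)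
    then show False by (simp add: is_unit_pCons_iff)
  qed
next
  assume nr: "\<forall>z. poly p z \<noteq> 0 \<or> poly q z \<noteq> 0"
  show "coprime p q"
  proof (rule coprimeI)
    fix d assume d: "d dvd p" "d dvd q"
    have "\<not> poly d z = 0" for z
      using d nr by (metis dvd_trans poly_eq_0_iff_dvd)
    then have "degree d = 0" using alg_closed_imp_poly_has_root by blast
    moreover have "d \<noteq> 0" using \<open>\<And>z. \<not> poly d z = 0\<close> by auto
    ultimately show "is_unit d" by (simp add: is_unit_iff_degree)
  qed
qed

definition lowest_terms :: "nat \<Rightarrow> complex poly \<Rightarrow> complex poly \<Rightarrow> bool" where
  "lowest_terms n p q \<longleftrightarrow> coprime p q \<and> max (degree p) (degree q) = n"

lemma rational_of_degree_iff:
  "rational_of_degree n F \<longleftrightarrow> (\<exists>p q. lowest_terms n p q \<and> F = ratmap p q)"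
  by (auto simp: rational_of_degree_def lowest_terms_def)

lemma lowest_terms_degree:
  assumes "lowest_terms n p q"
  shows "degree p \<le> n" "degree q \<le> n"
  using assms by (auto simp: lowest_terms_def)

lemma lowest_terms_root: "lowest_terms n p q \<Longrightarrow> poly p z \<noteq> 0 \<or> poly q z \<noteq> 0"
  by (auto simp: lowest_terms_def complex_coprime_iff_no_common_root)

text \<open>The counterpart at infinity of \<open>lowest_terms_root\<close>. The zero polynomial,
  whose degree 0 may equal n, has to be excluded separately.\<close>

lemma lowest_terms_coeff:
  assumes "lowest_terms n p q"
  shows "coeff p n \<noteq> 0 \<or> coeff q n \<noteq> 0"
proof (rule ccontr)
  assume a: "\<not> ?thesis"
  have "p = 0 \<and> q = 0"
  proof (cases "degree p = n")
    case True
    then have "p = 0" using a by auto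
    then have "degree q = n" using assms by (auto simp: lowest_terms_def)
    then show ?thesis using a \<open>p = 0\<close> by auto
  next
    case False
    then have "degree q = n" using assms by (auto simp: lowest_terms_def max_def split: if_splits)
    then have "q = 0" using a by auto
    then have "degree p = n" using assms by (auto simp: lowest_terms_def)
    then show ?thesis using False by simp
  qed
  then show False using lowest_terms_root[OF assms, of 0] by simp
qed

lemma lowest_termsI:
  assumes "\<And>z. poly p z \<noteq> 0 \<or> poly q z \<noteq> 0" "degree p \<le> n" "degree q \<le> n"
    "coeff p n \<noteq> 0 \<or> coeff q n \<noteq> 0"
  shows "lowest_terms n p q"
  unfolding lowest_terms_def complex_coprime_iff_no_common_root
  using assms le_degree[of p n] le_degree[of q n] by fastforce

lemma hom_eval_no_common_zero:
  assumes "lowest_terms n p q" "u \<noteq> 0 \<or> v \<noteq> 0"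
  shows "hom_eval n p u v \<noteq> 0 \<or> hom_eval n q u v \<noteq> 0"
proof (cases "v = 0")
  case True
  then show ?thesis using lowest_terms_coeff[OF assms(1)] assms(2) by (simp add: hom_eval_zero)
next
  case False
  then show ?thesis using lowest_terms_root[OF assms(1), of "u / v"] lowest_terms_degree[OF assms(1)]
    by (simp add: hom_eval_nonzero)
qed

lemma ratmap_hpoint:
  assumes "lowest_terms n p q" "u \<noteq> 0 \<or> v \<noteq> 0"
  shows "ratmap p q (hpoint u v) = hpoint (hom_eval n p u v) (hom_eval n q u v)"
proof (cases "v = 0")
  case True
  then show ?thesis using assms
    by (simp add: hom_eval_zero hpoint_def lowest_terms_def)
next
  case False
  have "hpoint (hom_eval n p u v) (hom_eval n q u v) = hpoint (poly p (u / v)) (poly q (u / v))"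
    using False hom_eval_nonzero[OF _ False] lowest_terms_degree[OF assms(1)]
    by (simp add: hpoint_scale)
  then show ?thesis using False by (simp add: hpoint_def)
qed

lemma ratmap_Infty:
  assumes "lowest_terms n p q"
  shows "ratmap p q Infty = hpoint (coeff p n) (coeff q n)"
  using assms by (simp add: lowest_terms_def)

section \<open>Substitution and the degree of a composite\<close>

lemma coeff_mult_le:
  fixes p q :: "'a::comm_semiring_0 poly"
  assumes "degree p \<le> m" "degree q \<le> n"
  shows "coeff (p * q) (m + n) = coeff p m * coeff q n"
proof -
  have "coeff p i * coeff q (m + n - i) = 0" if "i \<noteq> m" for i
  proof (cases "i < m")
    case True
    then have "degree q < m + n - i" using assms by simp
    then show ?thesis by (simp add: coeff_eq_0)
  next
    case False
    then show ?thesis using that assms by (simp add: coeff_eq_0)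
  qed
  then have "coeff (p * q) (m + n) = (\<Sum>i\<le>m + n. if i = m then coeff p m * coeff q n else 0)"
    unfolding coeff_mult by (intro sum.cong) auto
  then show ?thesis by simp
qed

lemma coeff_power_le:
  fixes p :: "'a::comm_semiring_1 poly"
  assumes "degree p \<le> m"
  shows "coeff (p ^ i) (m * i) = coeff p m ^ i"
proof (induction i)
  case (Suc i)
  have "degree (p ^ i) \<le> m * i" using assms
    by (meson degree_power_le dual_order.trans mult_le_mono1)
  then have "coeff (p * p ^ i) (m + m * i) = coeff p m * coeff (p ^ i) (m * i)"
    using assms by (rule coeff_mult_le[rotated])
  then show ?case using Suc by simp
qed simp

text \<open>This is p (r / s) cleared of denominators by s^n: the numerator of a composite and, with
  q in place of p, its denominator.\<close>

definition hom_comp :: "nat \<Rightarrow> complex poly \<Rightarrow> complex poly \<Rightarrow> complex poly \<Rightarrow> complex poly" where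
  "hom_comp n p r s = (\<Sum>i\<le>n. smult (coeff p i) (r ^ i * s ^ (n - i)))"

lemma poly_hom_comp: "poly (hom_comp n p r s) z = hom_eval n p (poly r z) (poly s z)"
  by (simp add: hom_comp_def hom_eval_def poly_sum mult.assoc)

lemma hom_comp_degree:
  assumes "degree r \<le> m" "degree s \<le> m"
  shows "degree (hom_comp n p r s) \<le> n * m"
    and "coeff (hom_comp n p r s) (n * m) = hom_eval n p (coeff r m) (coeff s m)"
proof -
  have d: "degree (r ^ i) \<le> m * i" "degree (s ^ i) \<le> m * i" for i
    using assms by (meson degree_power_le dual_order.trans mult_le_mono1)+
  have e: "m * i + m * (n - i) = n * m" if "i \<le> n" for i
    using that by (metis add_mult_distrib2 le_add_diff_inverse mult.commute)
  have "degree (smult (coeff p i) (r ^ i * s ^ (n - i))) \<le> n * m" if "i \<le> n" for i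
    using degree_mult_le[of "r ^ i" "s ^ (n - i)"] d(1)[of i] d(2)[of "n - i"] e[OF that]
      degree_smult_le[of "coeff p i" "r ^ i * s ^ (n - i)"] by linarith
  then show "degree (hom_comp n p r s) \<le> n * m"
    unfolding hom_comp_def by (intro degree_sum_le) auto
  have "coeff (r ^ i * s ^ (n - i)) (n * m) = coeff r m ^ i * coeff s m ^ (n - i)" if "i \<le> n" for i
    using coeff_mult_le[OF d(1)[of i] d(2)[of "n - i"]] coeff_power_le[OF assms(1)]
      coeff_power_le[OF assms(2)] e[OF that] by simp
  then show "coeff (hom_comp n p r s) (n * m) = hom_eval n p (coeff r m) (coeff s m)"
    by (simp add: hom_comp_def hom_eval_def coeff_sum mult.assoc)
qed

text \<open>The pair (r, s) vanishes nowhere on the sphere, and the homogenisations of p and q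
  vanish together only at (0, 0). So nothing cancels after substitution, and the degree is exactly
  the product.\<close>

lemma rational_of_degree_comp:
  assumes "rational_of_degree n F" "rational_of_degree m G"
  shows "rational_of_degree (n * m) (F \<circ> G)"
proof -
  obtain p q where pq: "lowest_terms n p q" "F = ratmap p q"
    using assms(1) by (auto simp: rational_of_degree_iff)
  obtain r s where rs: "lowest_terms m r s" "G = ratmap r s"
    using assms(2) by (auto simp: rational_of_degree_iff)
  note deg = lowest_terms_degree[OF rs(1)]
  have lt: "lowest_terms (n * m) (hom_comp n p r s) (hom_comp n q r s)"
    using hom_eval_no_common_zero[OF pq(1)] lowest_terms_root[OF rs(1)] lowest_terms_coeff[OF rs(1)]
    by (intro lowest_termsI hom_comp_degree(1) deg) (auto simp: poly_hom_comp hom_comp_degree(2) deg)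
  have "F (G x) = ratmap (hom_comp n p r s) (hom_comp n q r s) x" for x
  proof (cases x)
    case (Fin z)
    then show ?thesis using pq rs lowest_terms_root[OF rs(1)]
      by (simp add: ratmap_hpoint poly_hom_comp)
  next
    case Infty
    then show ?thesis using pq rs lowest_terms_coeff[OF rs(1)]
      by (simp add: ratmap_hpoint hom_comp_degree(2) deg ratmap_Infty[OF lt] ratmap_Infty[OF rs(1)] del: ratmap.simps)
  qed
  then show ?thesis using lt unfolding rational_of_degree_iff by fastforce
qed

lemma moebius_rational:
  assumes "moebius \<sigma>"
  shows "rational_of_degree 1 \<sigma>"
proof -
  obtain a b c d where s: "a * d - b * c \<noteq> 0" "\<sigma> = moebius_map a b c d"
    using assms moebius_def by auto
  have lt: "lowest_terms 1 [:b, a:] [:d, c:]"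
  proof (rule lowest_termsI)
    fix z show "poly [:b, a:] z \<noteq> 0 \<or> poly [:d, c:] z \<noteq> 0"
    proof (rule ccontr)
      assume "\<not> ?thesis"
      then have "b = - (z * a)" "d = - (z * c)" by (auto simp: add_eq_0_iff2)
      then show False using s(1) by simp
    qed
  qed (use s in \<open>auto\<close>)
  have "\<sigma> x = ratmap [:b, a:] [:d, c:] x" for x
    using s(2) by (cases x) (simp_all add: ratmap_Infty[OF lt] del: ratmap.simps(2), simp add: mult.commute add.commute)
  then show ?thesis using lt unfolding rational_of_degree_iff by fastforce
qed

lemma rational_of_degree_funpow:
  assumes "rational_of_degree n F"
  shows "rational_of_degree (n ^ k) (F ^^ k)"
proof (induction k)
  case 0
  then show ?case using moebius_rational[OF moebius_id] by (simp add: id_def)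
next
  case (Suc k)
  then show ?case using rational_of_degree_comp[OF assms Suc] by (simp add: comp_def)
qed

section \<open>Critical values and cardinalities of fibres\<close>

lemma sum_order_eq_degree:
  fixes p :: "complex poly"
  assumes "p \<noteq> 0"
  shows "(\<Sum>z | poly p z = 0. order z p) = degree p"
  using size_proots_complex[of p] assms by (simp add: size_multiset_overloaded_eq)

text \<open>Orders of roots are at least 1 and add up to the degree, so the number of roots reaches
  the degree only if all orders are 1.\<close>

lemma card_roots_rsquarefree:
  fixes p :: "complex poly"
  assumes "p \<noteq> 0"
  shows "card {z. poly p z = 0} \<le> degree p"
    and "card {z. poly p z = 0} = degree p \<longleftrightarrow> (\<forall>z. \<not> (poly p z = 0 \<and> poly (pderiv p) z = 0))"
proof -
  let ?R = "{z. poly p z = 0}"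
  have fin: "finite ?R" using assms by (rule poly_roots_finite)
  have pos: "1 \<le> order z p" if "z \<in> ?R" for z
    using that assms by (simp add: order_root Suc_le_eq)
  show "card ?R \<le> degree p"
    using sum_mono[of ?R "\<lambda>_. 1" "\<lambda>z. order z p"] pos sum_order_eq_degree[OF assms] by simp
  have "card ?R = degree p \<longleftrightarrow> (\<Sum>z\<in>?R. 1) = (\<Sum>z\<in>?R. order z p)"
    using sum_order_eq_degree[OF assms] by simp
  also have "\<dots> \<longleftrightarrow> (\<forall>z\<in>?R. 1 = order z p)"
    using sum_mono_inv[of "\<lambda>_. 1" ?R "\<lambda>z. order z p"] fin pos by (metis (no_types, lifting) sum.cong)
  also have "\<dots> \<longleftrightarrow> rsquarefree p"
    using assms unfolding rsquarefree_def order_root by (auto, metis One_nat_def not_gr_zero)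
  finally show "card ?R = degree p \<longleftrightarrow> (\<forall>z. \<not> (poly p z = 0 \<and> poly (pderiv p) z = 0))"
    by (simp add: rsquarefree_roots)
qed

section \<open>Critical points in charts\<close>

lemma chart_hpoint:
  "chart (hpoint a b) (hpoint u v) = (if b = 0 then v / u else u / v)"
  by (auto simp: hpoint_def)

text \<open>At the point, (P, Q) is proportional to (a, b). Hence the derivative of b P - a Q is
  there a nonzero multiple of P' Q - P Q', which decides criticality in either chart of the
  target.\<close>

lemma critical_point_local:
  assumes F: "\<And>t. F (chart_inv x t) = hpoint (poly P t) (poly Q t)"
    and x: "chart_inv x (chart x x) = x"
    and nz: "poly P (chart x x) \<noteq> 0 \<or> poly Q (chart x x) \<noteq> 0"
    and ab: "F x = hpoint a b" "a \<noteq> 0 \<or> b \<noteq> 0"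
  shows "critical_point F x \<longleftrightarrow> poly (pderiv (smult b P - smult a Q)) (chart x x) = 0"
proof -
  define t where "t = chart x x"
  have "hpoint a b = hpoint (poly P t) (poly Q t)" using F[of t] x ab by (simp add: t_def)
  then have eq: "a * poly Q t = poly P t * b"
    using hpoint_eq_iff[OF ab(2) nz] by (simp add: t_def)
  have comp: "chart (F x) \<circ> F \<circ> chart_inv x =
      (if b = 0 then (\<lambda>t. poly Q t / poly P t) else (\<lambda>t. poly P t / poly Q t))"
    by (auto simp: fun_eq_iff F ab(1) chart_hpoint)
  have zero: "critical_point F x \<longleftrightarrow> D = 0"
    if "((chart (F x) \<circ> F \<circ> chart_inv x) has_field_derivative D) (at t)" for D
    using that unfolding critical_point_def t_def by (metis DERIV_unique)
  show ?thesis
  proof (cases "b = 0")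
    case True
    then have a: "a \<noteq> 0" and q: "poly Q t = 0" and p: "poly P t \<noteq> 0"
      using ab(2) eq nz by (auto simp: t_def)
    have "((\<lambda>t. poly Q t / poly P t) has_field_derivative poly (pderiv Q) t / poly P t) (at t)"
      using p q by (auto intro!: derivative_eq_intros poly_DERIV simp: field_simps)
    then have "critical_point F x \<longleftrightarrow> poly (pderiv Q) t / poly P t = 0"
      using zero True by (simp add: comp)
    then show ?thesis using True p a by (simp add: t_def pderiv_diff pderiv_smult pderiv_minus)
  next
    case False
    then have q: "poly Q t \<noteq> 0" using eq nz by (auto simp: t_def)
    have a: "a = b * poly P t / poly Q t" using eq q by (simp add: field_simps)
    have "((\<lambda>t. poly P t / poly Q t) has_field_derivative
        (poly (pderiv P) t * poly Q t - poly P t * poly (pderiv Q) t) / (poly Q t * poly Q t)) (at t)"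
      using q by (auto intro!: derivative_eq_intros poly_DERIV)
    then have "critical_point F x \<longleftrightarrow> poly (pderiv P) t * poly Q t - poly P t * poly (pderiv Q) t = 0"
      using zero False q by (fastforce simp: comp)
    moreover have "poly (pderiv (smult b P - smult a Q)) t =
        b * (poly (pderiv P) t * poly Q t - poly P t * poly (pderiv Q) t) / poly Q t"
      unfolding a using q by (simp add: pderiv_diff pderiv_smult field_simps)
    ultimately show ?thesis using False q by (simp add: t_def)
  qed
qed

lemma chart_inv_chart: "chart_inv x (chart x x) = x"
  by (cases x) (auto simp: hpoint_def)

text \<open>The coefficients reversed in degree \<open>n\<close>: the expression of \<open>p\<close> in the chart at infinity.\<close>

definition rev_poly :: "nat \<Rightarrow> complex poly \<Rightarrow> complex poly" where
  "rev_poly n p = (\<Sum>i\<le>n. monom (coeff p i) (n - i))"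

lemma poly_rev_poly: "poly (rev_poly n p) t = hom_eval n p 1 t"
  by (simp add: rev_poly_def hom_eval_def poly_sum poly_monom)

lemma coeff_rev_poly:
  assumes "i \<le> n"
  shows "coeff (rev_poly n p) i = coeff p (n - i)"
proof -
  have "coeff (rev_poly n p) i = (\<Sum>j\<le>n. if j = n - i then coeff p j else 0)"
    unfolding rev_poly_def coeff_sum using assms by (intro sum.cong) auto
  then show ?thesis by simp
qed

lemma rev_poly_diff: "rev_poly n (smult b p - smult a q) = smult b (rev_poly n p) - smult a (rev_poly n q)"
  by (simp add: poly_eq_poly_eq_iff[symmetric] fun_eq_iff poly_rev_poly hom_eval_def
      sum_distrib_left sum_subtractf algebra_simps)

text \<open>The polynomial whose roots are the finite points of the fibre of \<open>p / q\<close> over \<open>[a : b]\<close>;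
  the fibre contains infinity if its coefficient in degree \<open>n\<close> vanishes.\<close>

definition fibre_poly :: "complex poly \<Rightarrow> complex poly \<Rightarrow> complex \<Rightarrow> complex \<Rightarrow> complex poly" where
  "fibre_poly p q a b = smult b p - smult a q"

text \<open>If b p = a q and p has a root, then q does not vanish there, so a = 0 and p = 0, which
  is absurd for nonconstant p. By symmetry both p and q are constant, against n >= 1.\<close>

lemma fibre_poly_nonzero:
  assumes lt: "lowest_terms n p q" and "n \<ge> 1" and ab: "a \<noteq> 0 \<or> b \<noteq> 0"
  shows "fibre_poly p q a b \<noteq> 0"
proof
  assume z: "fibre_poly p q a b = 0"
  then have e: "b * poly p z = a * poly q z" for z
    by (metis eq_iff_diff_eq_0 fibre_poly_def poly_diff poly_smult poly_0)
  have "degree p = 0 \<and> degree q = 0"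
  proof (intro conjI; rule ccontr)
    assume "degree p \<noteq> 0"
    then obtain z where "poly p z = 0" using alg_closed_imp_poly_has_root by blast
    then have "a = 0" "b \<noteq> 0" using e[of z] lowest_terms_root[OF lt, of z] ab by auto
    then have "p = 0" using z by (simp add: fibre_poly_def)
    then show False using \<open>degree p \<noteq> 0\<close> by simp
  next
    assume "degree q \<noteq> 0"
    then obtain z where "poly q z = 0" using alg_closed_imp_poly_has_root by blast
    then have "b = 0" "a \<noteq> 0" using e[of z] lowest_terms_root[OF lt, of z] ab by auto
    then have "q = 0" using z by (simp add: fibre_poly_def)
    then show False using \<open>degree q \<noteq> 0\<close> by simp
  qed
  then show False using lt \<open>n \<ge> 1\<close> by (simp add: lowest_terms_def)
qed

lemma fibre_poly_degree:
  "lowest_terms n p q \<Longrightarrow> degree (fibre_poly p q a b) \<le> n"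
  unfolding fibre_poly_def using lowest_terms_degree[of n p q]
  by (meson degree_diff_le degree_smult_le order.trans)

lemma ratmap_eq_iff:
  assumes lt: "lowest_terms n p q" and ab: "a \<noteq> 0 \<or> b \<noteq> 0"
  shows "ratmap p q (Fin z) = hpoint a b \<longleftrightarrow> poly (fibre_poly p q a b) z = 0"
    and "ratmap p q Infty = hpoint a b \<longleftrightarrow> coeff (fibre_poly p q a b) n = 0"
proof -
  show "ratmap p q (Fin z) = hpoint a b \<longleftrightarrow> poly (fibre_poly p q a b) z = 0"
    by (simp add: hpoint_eq_iff[OF lowest_terms_root[OF lt] ab] fibre_poly_def mult.commute)
  show "ratmap p q Infty = hpoint a b \<longleftrightarrow> coeff (fibre_poly p q a b) n = 0"
    unfolding ratmap_Infty[OF lt] hpoint_eq_iff[OF lowest_terms_coeff[OF lt] ab]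
    by (simp add: fibre_poly_def mult.commute)
qed

lemma critical_point_ratmap:
  assumes lt: "lowest_terms n p q" and ab: "a \<noteq> 0 \<or> b \<noteq> 0" and "n \<ge> 1"
  shows "ratmap p q (Fin z) = hpoint a b \<Longrightarrow>
      critical_point (ratmap p q) (Fin z) \<longleftrightarrow> poly (pderiv (fibre_poly p q a b)) z = 0"
    and "ratmap p q Infty = hpoint a b \<Longrightarrow>
      critical_point (ratmap p q) Infty \<longleftrightarrow> coeff (fibre_poly p q a b) (n - 1) = 0"
proof -
  assume "ratmap p q (Fin z) = hpoint a b"
  then show "critical_point (ratmap p q) (Fin z) \<longleftrightarrow> poly (pderiv (fibre_poly p q a b)) z = 0"
    using critical_point_local[of "ratmap p q" "Fin z" p q a b] lowest_terms_root[OF lt] ab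
    by (simp add: fibre_poly_def)
next
  assume I: "ratmap p q Infty = hpoint a b"
  have F: "ratmap p q (chart_inv Infty t) = hpoint (poly (rev_poly n p) t) (poly (rev_poly n q) t)" for t
    using ratmap_hpoint[OF lt, of 1 t] by (simp add: poly_rev_poly)
  have "critical_point (ratmap p q) Infty \<longleftrightarrow>
      poly (pderiv (smult b (rev_poly n p) - smult a (rev_poly n q))) 0 = 0"
    using critical_point_local[OF F chart_inv_chart _ I ab] hom_eval_no_common_zero[OF lt, of 1 0]
    by (simp add: poly_rev_poly)
  \<comment> \<open>The derivative at 0 of the reversed polynomial is its linear coefficient, which
    before reversal stood in degree n - 1.\<close>
  also have "\<dots> \<longleftrightarrow> coeff (fibre_poly p q a b) (n - 1) = 0"
    unfolding rev_poly_diff[symmetric] fibre_poly_def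
    using coeff_rev_poly[of 1 n "smult b p - smult a q"] \<open>n \<ge> 1\<close>
    by (simp add: poly_0_coeff_0 coeff_pderiv)
  finally show "critical_point (ratmap p q) Infty \<longleftrightarrow> coeff (fibre_poly p q a b) (n - 1) = 0" .
qed

lemma fibre_eq:
  assumes lt: "lowest_terms n p q" and ab: "a \<noteq> 0 \<or> b \<noteq> 0"
  shows "ratmap p q -` {hpoint a b} = Fin ` {z. poly (fibre_poly p q a b) z = 0} \<union>
    (if coeff (fibre_poly p q a b) n = 0 then {Infty} else {})"
proof (rule set_eqI)
  fix x show "x \<in> ratmap p q -` {hpoint a b} \<longleftrightarrow> x \<in> Fin ` {z. poly (fibre_poly p q a b) z = 0} \<union>
    (if coeff (fibre_poly p q a b) n = 0 then {Infty} else {})"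
    using ratmap_eq_iff[OF lt ab] by (cases x) (auto simp del: ratmap.simps)
qed

lemma card_fibre:
  assumes lt: "lowest_terms n p q" and ab: "a \<noteq> 0 \<or> b \<noteq> 0" and "n \<ge> 1"
  shows "finite (ratmap p q -` {hpoint a b})"
    and "card (ratmap p q -` {hpoint a b}) = card {z. poly (fibre_poly p q a b) z = 0} +
      (if coeff (fibre_poly p q a b) n = 0 then 1 else 0)"
proof -
  have fin: "finite {z. poly (fibre_poly p q a b) z = 0}"
    using fibre_poly_nonzero[OF lt \<open>n \<ge> 1\<close> ab] by (rule poly_roots_finite)
  then show "finite (ratmap p q -` {hpoint a b})" unfolding fibre_eq[OF lt ab] by auto
  have "card (Fin ` {z. poly (fibre_poly p q a b) z = 0}) = card {z. poly (fibre_poly p q a b) z = 0}"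
    by (intro card_image inj_onI) simp
  then show "card (ratmap p q -` {hpoint a b}) = card {z. poly (fibre_poly p q a b) z = 0} +
      (if coeff (fibre_poly p q a b) n = 0 then 1 else 0)"
    unfolding fibre_eq[OF lt ab] using fin by (auto simp: card_Un_disjoint image_iff)
qed

text \<open>Infinity counts as a root of G of multiplicity n - degree G. Multiplicity 1 there makes
  up for the missing finite root, so a point is lost only at a multiple finite root or if the degree
  drops by at least 2.\<close>

lemma card_fibre_less_iff:
  assumes lt: "lowest_terms n p q" and ab: "a \<noteq> 0 \<or> b \<noteq> 0" and "n \<ge> 1"
  defines "G \<equiv> fibre_poly p q a b"
  shows "card (ratmap p q -` {hpoint a b}) \<le> n"
    and "card (ratmap p q -` {hpoint a b}) < n \<longleftrightarrow>
      (\<exists>z. poly G z = 0 \<and> poly (pderiv G) z = 0) \<or> coeff G n = 0 \<and> coeff G (n - 1) = 0"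
proof -
  have G0: "G \<noteq> 0" unfolding G_def by (rule fibre_poly_nonzero[OF lt \<open>n \<ge> 1\<close> ab])
  have d: "degree G \<le> n" unfolding G_def by (rule fibre_poly_degree[OF lt])
  note c = card_fibre(2)[OF lt ab \<open>n \<ge> 1\<close>, folded G_def]
  note r = card_roots_rsquarefree[OF G0]
  have t: "coeff G n = 0 \<longleftrightarrow> degree G < n"
    using d G0 by (metis coeff_eq_0 le_neq_implies_less leading_coeff_0_iff)
  have t': "coeff G n = 0 \<and> coeff G (n - 1) = 0 \<longleftrightarrow> degree G < n - 1"
  proof
    assume "coeff G n = 0 \<and> coeff G (n - 1) = 0"
    then have "degree G \<le> n - 1" "degree G \<noteq> n - 1" using t G0 by (auto, metis leading_coeff_0_iff)
    then show "degree G < n - 1" by simp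
  qed (simp add: coeff_eq_0)
  show "card (ratmap p q -` {hpoint a b}) \<le> n" using c r(1) t d by (auto split: if_splits)
  show "card (ratmap p q -` {hpoint a b}) < n \<longleftrightarrow>
      (\<exists>z. poly G z = 0 \<and> poly (pderiv G) z = 0) \<or> coeff G n = 0 \<and> coeff G (n - 1) = 0"
    unfolding t' using c r t d by (auto split: if_splits)
qed

text \<open>Each way for a fibre to lose a point is a critical point in it: a multiple root at a
  finite point, a drop of the degree by two at infinity. Later arguments use critical values only
  through this count.\<close>

lemma critical_values_iff:
  assumes "rational_of_degree n F" "n \<ge> 1"
  shows "y \<in> critical_values F \<longleftrightarrow> card (F -` {y}) < n"
proof -
  obtain p q where lt: "lowest_terms n p q" and F: "F = ratmap p q"
    using assms(1) by (auto simp: rational_of_degree_iff)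
  obtain a b where y: "y = hpoint a b" and ab: "a \<noteq> 0 \<or> b \<noteq> 0" by (rule hpoint_cases)
  have ex: "(\<exists>x. P x) \<longleftrightarrow> (\<exists>z. P (Fin z)) \<or> P Infty" for P by (metis cp1.exhaust)
  have "y \<in> critical_values F \<longleftrightarrow> (\<exists>x. F x = hpoint a b \<and> critical_point F x)"
    by (simp add: critical_values_def y image_iff) metis
  also have "\<dots> \<longleftrightarrow> card (F -` {y}) < n"
    unfolding ex y F card_fibre_less_iff(2)[OF lt ab assms(2)]
    using critical_point_ratmap[OF lt ab assms(2)] ratmap_eq_iff[OF lt ab] by blast
  finally show ?thesis .
qed

lemma rational_fibre:
  assumes "rational_of_degree n F" "n \<ge> 1"
  shows "finite (F -` {y})" and "card (F -` {y}) \<le> n"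
proof -
  obtain p q where lt: "lowest_terms n p q" and F: "F = ratmap p q"
    using assms(1) by (auto simp: rational_of_degree_iff)
  obtain a b where y: "y = hpoint a b" and ab: "a \<noteq> 0 \<or> b \<noteq> 0" by (rule hpoint_cases)
  show "finite (F -` {y})" "card (F -` {y}) \<le> n"
    unfolding F y using card_fibre(1)[OF lt ab assms(2)] card_fibre_less_iff(1)[OF lt ab assms(2)] by auto
qed

section \<open>The Riemann--Hurwitz formula\<close>

definition wronskian :: "complex poly \<Rightarrow> complex poly \<Rightarrow> complex poly" where
  "wronskian p q = pderiv p * q - p * pderiv q"

text \<open>If p' q = p q', then at a root of q, where p does not vanish, the left side has at least
  the order of q and the right side one less. So q is constant, and then so is p.\<close>

lemma wronskian_nonzero:
  assumes lt: "lowest_terms n p q" and "n \<ge> 1"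
  shows "wronskian p q \<noteq> 0"
proof
  assume "wronskian p q = 0"
  then have e: "pderiv p * q = p * pderiv q" by (simp add: wronskian_def)
  have "q \<noteq> 0"
  proof
    assume "q = 0"
    then have "degree p = 0" using lowest_terms_root[OF lt] alg_closed_imp_poly_has_root[of p] by auto
    then show False using lt \<open>n \<ge> 1\<close> \<open>q = 0\<close> by (simp add: lowest_terms_def)
  qed
  have "degree q = 0"
  proof (rule ccontr)
    assume "degree q \<noteq> 0"
    then obtain z where z: "poly q z = 0" using alg_closed_imp_poly_has_root by blast
    then have p: "poly p z \<noteq> 0" using lowest_terms_root[OF lt, of z] by simp
    have "pderiv q \<noteq> 0" using \<open>degree q \<noteq> 0\<close> by (simp add: pderiv_eq_0_iff)
    then have "p * pderiv q \<noteq> 0" using p by auto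
    then have "order z (pderiv p) + order z q = order z (pderiv q)"
      using p order_mult[of "pderiv p" q z] order_mult[of p "pderiv q" z] e by (simp add: order_0I)
    then show False using order_pderiv[OF \<open>q \<noteq> 0\<close> z] by simp
  qed
  then have "pderiv q = 0" by (simp add: pderiv_eq_0_iff)
  then have "pderiv p = 0" using e \<open>q \<noteq> 0\<close> by simp
  then have "degree p = 0" by (simp add: pderiv_eq_0_iff)
  then show False using \<open>degree q = 0\<close> lt \<open>n \<ge> 1\<close> by (simp add: lowest_terms_def)
qed

text \<open>Subtracting a multiple of q from p leaves the Wronskian unchanged, so this one
  polynomial records the ramification over all finite values a.\<close>

lemma wronskian_fibre_poly:
  "wronskian p q = pderiv (fibre_poly p q a 1) * q - fibre_poly p q a 1 * pderiv q"
  by (simp add: wronskian_def fibre_poly_def pderiv_diff pderiv_smult algebra_simps)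

text \<open>A multiple root of a fibre polynomial is a root of the nonzero Wronskian. Infinity and
  the image of infinity escape this argument and are added to the finite set.\<close>

lemma finite_critical_values_ratmap:
  assumes lt: "lowest_terms n p q" and "n \<ge> 1"
  shows "finite {y. card (ratmap p q -` {y}) < n}"
proof -
  let ?X = "Fin ` (\<lambda>z. poly p z / poly q z) ` {z. poly (wronskian p q) z = 0} \<union> {Infty, ratmap p q Infty}"
  have "y \<in> ?X" if c: "card (ratmap p q -` {y}) < n" for y
  proof (cases y)
    case (Fin a)
    then have y: "y = hpoint a 1" by (simp add: hpoint_def)
    let ?G = "fibre_poly p q a 1"
    consider z where "poly ?G z = 0" "poly (pderiv ?G) z = 0" | "coeff ?G n = 0"
      using c unfolding y card_fibre_less_iff(2)[OF lt _ \<open>n \<ge> 1\<close>, of a 1, simplified] by auto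
    then show ?thesis
    proof cases
      case (1 z)
      then have "poly (wronskian p q) z = 0" unfolding wronskian_fibre_poly[of p q a] by simp
      moreover have "poly p z / poly q z = a"
        using 1(1) lowest_terms_root[OF lt, of z] by (auto simp: fibre_poly_def field_simps)
      ultimately show ?thesis using Fin by auto
    next
      case 2
      then show ?thesis using ratmap_eq_iff(2)[OF lt, of a 1] y by auto
    qed
  qed auto
  then have "{y. card (ratmap p q -` {y}) < n} \<subseteq> ?X" by blast
  moreover have "finite ?X"
    using poly_roots_finite[OF wronskian_nonzero[OF lt \<open>n \<ge> 1\<close>]] by auto
  ultimately show ?thesis by (rule finite_subset)
qed

text \<open>Let G have order k at z. As q does not vanish at z, G' q has order k - 1, while G q' has
  order at least k and cannot cancel it.\<close>

lemma order_wronskian: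
  assumes lt: "lowest_terms n p q" and "n \<ge> 1" and z: "poly (fibre_poly p q a 1) z = 0"
    and d: "pderiv (fibre_poly p q a 1) \<noteq> 0"
  shows "order z (wronskian p q) = order z (fibre_poly p q a 1) - 1"
proof -
  let ?G = "fibre_poly p q a 1"
  define e where "e = order z (pderiv ?G)"
  have G0: "?G \<noteq> 0" by (rule fibre_poly_nonzero[OF lt \<open>n \<ge> 1\<close>]) simp
  have e: "order z ?G = Suc e" unfolding e_def by (rule order_pderiv[OF G0 z])
  have q: "poly q z \<noteq> 0" using z lowest_terms_root[OF lt, of z] by (auto simp: fibre_poly_def)
  then have q0: "q \<noteq> 0" by auto
  let ?A = "pderiv ?G * q"
  have oA: "order z ?A = e"
    using q d q0 by (simp add: order_mult order_0I e_def)
  have A0: "?A \<noteq> 0" using d q0 by simp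
  have B: "[:-z, 1:] ^ Suc e dvd ?G * pderiv q" using order_1[of z ?G] e by (simp add: dvd_mult2)
  have W: "wronskian p q = ?A - ?G * pderiv q" by (rule wronskian_fibre_poly)
  have "[:-z, 1:] ^ e dvd ?A" "[:-z, 1:] ^ e dvd ?G * pderiv q"
    using order_1[of z ?A] oA power_le_dvd[OF B, of e] by simp_all
  then have "[:-z, 1:] ^ e dvd wronskian p q" unfolding W by (rule dvd_diff)
  moreover have "\<not> [:-z, 1:] ^ Suc e dvd wronskian p q"
  proof
    assume "[:-z, 1:] ^ Suc e dvd wronskian p q"
    then have "[:-z, 1:] ^ Suc e dvd wronskian p q + ?G * pderiv q" using B by (rule dvd_add)
    then show False using order_divides[of z "Suc e" ?A] A0 oA by (simp add: W)
  qed
  ultimately have "order z (wronskian p q) = e" by (metis order_unique_lemma)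
  then show ?thesis using e by simp
qed

text \<open>Here infinity is mapped to itself and is not a critical value. Then the Wronskian has
  degree 2 n - 2, and its roots in one fibre have total order n minus the size of the fibre.\<close>

lemma riemann_hurwitz_normalised:
  assumes lt: "lowest_terms n p q" and n: "n \<ge> 2" and I: "coeff q n = 0" and T: "finite T"
    and crit: "{y. card (ratmap p q -` {y}) < n} \<subseteq> Fin ` T"
  shows "(\<Sum>a\<in>T. n - card (ratmap p q -` {Fin a})) = 2 * n - 2"
proof -
  have n1: "n \<ge> 1" using n by simp
  let ?G = "\<lambda>a. fibre_poly p q a 1" and ?W = "wronskian p q"
  define R where "R a = {z. poly (?G a) z = 0}" for a
  have F: "Fin a = hpoint a 1" for a by (simp add: hpoint_def)
  note deg = lowest_terms_degree[OF lt]
  have p: "coeff p n \<noteq> 0" using lowest_terms_coeff[OF lt] I by simp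
  have Gn: "coeff (?G a) n \<noteq> 0" for a using p I by (simp add: fibre_poly_def)
  have Gdeg: "degree (?G a) = n" for a
    using fibre_poly_degree[OF lt, of a 1] Gn[of a] by (meson le_antisym le_degree)
  have G0: "?G a \<noteq> 0" for a using Gn[of a] by auto
  have dG: "pderiv (?G a) \<noteq> 0" for a using Gdeg[of a] n by (simp add: pderiv_eq_0_iff)
  \<comment> \<open>As infinity is not a critical value, its fibre consists of infinity and n - 1
    simple roots of q.\<close>
  have "\<not> card (ratmap p q -` {hpoint 1 0}) < n" using crit by (auto simp: hpoint_def)
  then have q: "coeff q (n - 1) \<noteq> 0" "\<And>z. \<not> (poly q z = 0 \<and> poly (pderiv q) z = 0)"
    unfolding card_fibre_less_iff(2)[OF lt _ n1, of 1 0, simplified]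
    using I by (auto simp: fibre_poly_def pderiv_minus)
  have degq: "degree q \<le> n - 1"
    using deg(2) I q(1) by (metis One_nat_def Suc_pred coeff_0 le_SucE leading_coeff_0_iff n1 less_eq_Suc_le)
  have W0: "?W \<noteq> 0" by (rule wronskian_nonzero[OF lt n1])
  have dp: "degree (pderiv p) \<le> n - 1" "degree (pderiv q) \<le> n - 2"
    using deg(1) degq by (auto simp: degree_pderiv)
  \<comment> \<open>In degree 2 n - 2 the two products have n and n - 1 times the same nonzero
    number as coefficients, so their difference is that number.\<close>
  have Wdeg: "degree ?W = 2 * n - 2"
  proof (rule antisym)
    have "degree (pderiv p * q) \<le> 2 * n - 2" "degree (p * pderiv q) \<le> 2 * n - 2"
      using degree_mult_le[of "pderiv p" q] degree_mult_le[of p "pderiv q"] dp deg(1) degq n by linarith+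
    then show "degree ?W \<le> 2 * n - 2" unfolding wronskian_def by (rule degree_diff_le)
    have "coeff (pderiv p * q) ((n - 1) + (n - 1)) = of_nat n * coeff p n * coeff q (n - 1)"
      using coeff_mult_le[OF dp(1) degq] n by (simp add: coeff_pderiv del: of_nat_Suc)
    moreover have "coeff (p * pderiv q) (n + (n - 2)) = coeff p n * (of_nat (n - 1) * coeff q (n - 1))"
      using coeff_mult_le[OF deg(1) dp(2)] n
      by (simp add: coeff_pderiv Suc_diff_Suc numeral_2_eq_2 del: of_nat_Suc of_nat_diff)
    moreover have "(n - 1) + (n - 1) = 2 * n - 2" "n + (n - 2) = 2 * n - 2" using n by auto
    ultimately have "coeff ?W (2 * n - 2) =
        of_nat n * coeff p n * coeff q (n - 1) - coeff p n * (of_nat (n - 1) * coeff q (n - 1))"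
      by (simp add: wronskian_def del: of_nat_diff)
    also have "\<dots> = coeff p n * coeff q (n - 1)"
      using n by (simp add: of_nat_diff algebra_simps)
    finally show "2 * n - 2 \<le> degree ?W" using p q(1) by (simp add: le_degree)
  qed
  have fin: "finite (R a)" for a unfolding R_def using G0 by (rule poly_roots_finite)
  have local: "n - card (ratmap p q -` {Fin a}) = (\<Sum>z\<in>R a. order z ?W)" for a
  proof -
    have "card (ratmap p q -` {Fin a}) = card (R a)"
      unfolding F R_def using card_fibre(2)[OF lt _ n1, of a 1] Gn[of a] by simp
    moreover have "(\<Sum>z\<in>R a. order z ?W) = (\<Sum>z\<in>R a. order z (?G a) - 1)"
      by (intro sum.cong refl order_wronskian[OF lt n1] dG) (simp add: R_def)
    moreover have "\<dots> = (\<Sum>z\<in>R a. order z (?G a)) - (\<Sum>z\<in>R a. 1)"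
      by (intro sum_subtractf_nat) (use G0 in \<open>auto simp: R_def order_root Suc_le_eq\<close>)
    moreover have "(\<Sum>z\<in>R a. order z (?G a)) = n"
      using sum_order_eq_degree[OF G0, of a] by (simp add: R_def Gdeg)
    ultimately show ?thesis by simp
  qed
  \<comment> \<open>A root of the Wronskian that is also a root of q would be a multiple root of q,
    so every root lies over a finite critical value.\<close>
  have cover: "\<exists>a\<in>T. z \<in> R a" if z: "poly ?W z = 0" for z
  proof -
    have qz: "poly q z \<noteq> 0"
    proof
      assume "poly q z = 0"
      then have "poly (pderiv q) z = 0" using z lowest_terms_root[OF lt, of z] by (auto simp: wronskian_def)
      then show False using q(2) \<open>poly q z = 0\<close> by blast
    qed
    define a where "a = poly p z / poly q z"
    have G: "poly (?G a) z = 0" using qz by (simp add: a_def fibre_poly_def)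
    then have "poly (pderiv (?G a)) z = 0" using z qz by (simp add: wronskian_fibre_poly[of p q a])
    then have "card (ratmap p q -` {Fin a}) < n"
      unfolding F using card_fibre_less_iff(2)[OF lt _ n1, of a 1] G by auto
    then have "Fin a \<in> Fin ` T" using crit by blast
    then show ?thesis using G by (auto simp: R_def)
  qed
  have disj: "R a \<inter> R b = {}" if "a \<noteq> b" for a b
  proof (rule ccontr)
    assume "R a \<inter> R b \<noteq> {}"
    then obtain z where "z \<in> R a" "z \<in> R b" by blast
    then have "poly p z = a * poly q z" "poly p z = b * poly q z"
      by (simp_all add: R_def fibre_poly_def)
    then show False using that lowest_terms_root[OF lt, of z] by auto
  qed
  have "(\<Sum>a\<in>T. n - card (ratmap p q -` {Fin a})) = (\<Sum>a\<in>T. \<Sum>z\<in>R a. order z ?W)"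
    by (simp add: local)
  also have "\<dots> = (\<Sum>z\<in>(\<Union>a\<in>T. R a). order z ?W)"
    using T fin disj by (intro sum.UNION_disjoint[symmetric]) auto
  \<comment> \<open>Points of the fibres that are not roots of the Wronskian contribute order
    0.\<close>
  also have "\<dots> = (\<Sum>z | poly ?W z = 0. order z ?W)"
    by (intro sum.mono_neutral_right) (use T fin cover W0 in \<open>auto simp: order_root\<close>)
  also have "\<dots> = 2 * n - 2" using sum_order_eq_degree[OF W0] Wdeg by simp
  finally show ?thesis .
qed

section \<open>Changes of coordinates and the general Riemann--Hurwitz formula\<close>

text \<open>The matrix whose columns are homogeneous coordinates of x and y sends infinity to x and
  0 to y; its inverse is the required map.\<close>

lemma moebius_two_points:
  assumes "x \<noteq> y"
  obtains \<mu> where "moebius \<mu>" "\<mu> x = Infty" "\<mu> y = Fin 0"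
proof -
  obtain a c where x: "x = hpoint a c" "a \<noteq> 0 \<or> c \<noteq> 0" by (rule hpoint_cases)
  obtain b d where y: "y = hpoint b d" "b \<noteq> 0 \<or> d \<noteq> 0" by (rule hpoint_cases)
  have "a * d - b * c \<noteq> 0" using assms x y hpoint_eq_iff[OF x(2) y(2)] by simp
  then have m: "moebius (moebius_map a b c d)" unfolding moebius_def by blast
  let ?m = "moebius_map a b c d"
  have "?m Infty = x" "?m (Fin 0) = y" using x y by auto
  then have "inv ?m x = Infty" "inv ?m y = Fin 0"
    using moebius_inverse[OF m] by (metis bij_inv_eq_iff)+
  then show ?thesis using that moebius_inverse[OF m] by blast
qed

lemma infinite_cp1: "infinite (UNIV :: cp1 set)"
proof
  assume "finite (UNIV :: cp1 set)"
  then have "finite (range Fin)" by (rule rev_finite_subset) simp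
  then show False using finite_imageD[of Fin UNIV] infinite_UNIV_char_0 by (auto simp: inj_on_def)
qed

lemma moebius_to_Infty: obtains \<mu> where "moebius \<mu>" "\<mu> x = Infty"
proof -
  obtain y where "x \<noteq> y" using infinite_cp1 by (metis cp1.distinct(1))
  then show ?thesis using that moebius_two_points by blast
qed

text \<open>Source and target may be given different coordinates, as the Riemann--Hurwitz formula
  needs; equal ones give a conjugation.\<close>

lemma moebius_conj_fibre:
  assumes "moebius \<mu>" "moebius \<rho>"
  shows "(\<rho> \<circ> F \<circ> inv \<mu>) -` {\<rho> y} = \<mu> ` (F -` {y})"
proof -
  have bij: "bij \<mu>" "bij \<rho>" using assms moebius_inverse by auto
  have "(\<rho> \<circ> F \<circ> inv \<mu>) -` {\<rho> y} = inv \<mu> -` (F -` {y})"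
    using bij(2) by (auto simp: bij_is_inj inj_eq)
  then show ?thesis using bij(1) by (metis bij_imp_bij_inv bij_vimage_eq_inv_image inv_inv_eq)
qed

lemma moebius_conj_rational:
  assumes "rational_of_degree n F" "moebius \<mu>" "moebius \<rho>"
  shows "rational_of_degree n (\<rho> \<circ> F \<circ> inv \<mu>)"
proof -
  have "rational_of_degree 1 (inv \<mu>)" "rational_of_degree 1 \<rho>"
    using assms moebius_inverse moebius_rational by blast+
  from rational_of_degree_comp[OF rational_of_degree_comp[OF this(2) assms(1)] this(1)]
  show ?thesis by simp
qed

lemma finite_critical_values:
  assumes "rational_of_degree n F" "n \<ge> 1"
  shows "finite (critical_values F)"
proof -
  have "critical_values F = {y. card (F -` {y}) < n}" using critical_values_iff[OF assms] by auto
  moreover obtain p q where "lowest_terms n p q" "F = ratmap p q"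
    using assms(1) by (auto simp: rational_of_degree_iff)
  ultimately show ?thesis using finite_critical_values_ratmap assms(2) by simp
qed

lemma finite_preimage:
  assumes "rational_of_degree n F" "n \<ge> 1" "finite S"
  shows "finite (F -` S)"
proof -
  have "F -` S = (\<Union>y\<in>S. F -` {y})" by auto
  then show ?thesis using assms rational_fibre(1) by simp
qed

text \<open>Some x has its image outside the finite set S. Moving x and F x to infinity keeps the
  sizes of fibres and reduces to the normalised case.\<close>

lemma riemann_hurwitz:
  assumes F: "rational_of_degree n F" and n: "n \<ge> 2" and S: "finite S" "critical_values F \<subseteq> S"
  shows "(\<Sum>y\<in>S. n - card (F -` {y})) = 2 * n - 2"
proof -
  have "finite (F -` S)" using finite_preimage[OF F] n S by simp
  then obtain x where "x \<notin> F -` S" using infinite_cp1 ex_new_if_finite by blast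
  then have x: "F x \<notin> S" by simp
  obtain \<mu> where \<mu>: "moebius \<mu>" "\<mu> x = Infty" by (rule moebius_to_Infty)
  obtain \<rho> where \<rho>: "moebius \<rho>" "\<rho> (F x) = Infty" by (rule moebius_to_Infty)
  have bij: "bij \<mu>" "bij \<rho>" using \<mu> \<rho> moebius_inverse by auto
  define F' where "F' = \<rho> \<circ> F \<circ> inv \<mu>"
  have rat: "rational_of_degree n F'" unfolding F'_def by (rule moebius_conj_rational[OF F \<mu>(1) \<rho>(1)])
  have "F' Infty = Infty" unfolding F'_def using \<mu> \<rho> bij by (metis bij_inv_eq_iff comp_apply)
  obtain p q where lt: "lowest_terms n p q" and F'eq: "F' = ratmap p q"
    using rat by (auto simp: rational_of_degree_iff)
  have q: "coeff q n = 0"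
    using \<open>F' Infty = Infty\<close> ratmap_Infty[OF lt] by (auto simp: F'eq hpoint_def split: if_splits simp del: ratmap.simps)
  have fib: "card (F' -` {\<rho> y}) = card (F -` {y})" for y
    unfolding F'_def moebius_conj_fibre[OF \<mu>(1) \<rho>(1)] using bij_is_inj[OF bij(1)] by (intro card_image) (rule inj_on_subset, auto)
  define T where "T = {a. Fin a \<in> \<rho> ` S}"
  have "Infty \<notin> \<rho> ` S" using \<rho>(2) x bij by (metis bij_is_inj image_iff inj_eq)
  then have T: "Fin ` T = \<rho> ` S"
    unfolding T_def by (auto simp: image_iff) (metis cp1.exhaust)
  have finT: "finite T" using S(1) T by (metis finite_imageD finite_imageI cp1.inject inj_onI)
  have crit: "{y. card (F' -` {y}) < n} \<subseteq> Fin ` T"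
  proof
    fix y assume "y \<in> {y. card (F' -` {y}) < n}"
    moreover obtain w where "y = \<rho> w" using bij by (metis bij_pointE)
    ultimately show "y \<in> Fin ` T" using S(2) n by (auto simp: T fib critical_values_iff[OF F])
  qed
  have "(\<Sum>y\<in>S. n - card (F -` {y})) = (\<Sum>y\<in>\<rho> ` S. n - card (F' -` {y}))"
    using inj_on_subset[OF bij_is_inj[OF bij(2)]] by (subst sum.reindex) (auto simp: fib)
  also have "\<dots> = (\<Sum>a\<in>T. n - card (F' -` {Fin a}))"
    unfolding T[symmetric] by (subst sum.reindex) (auto simp: inj_on_def)
  also have "\<dots> = 2 * n - 2"
    unfolding F'eq by (rule riemann_hurwitz_normalised[OF lt n q finT crit[unfolded F'eq]])
  finally show ?thesis .
qed

section \<open>Sizes of preimages and the number of critical values\<close>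

lemma card_preimage:
  assumes "rational_of_degree n F" "n \<ge> 1" "finite S"
  shows "card (F -` S) = (\<Sum>y\<in>S. card (F -` {y}))"
proof -
  have "F -` S = (\<Union>y\<in>S. F -` {y})" by auto
  moreover have "card (\<Union>y\<in>S. F -` {y}) = (\<Sum>y\<in>S. card (F -` {y}))"
    using rational_fibre(1)[OF assms(1,2)] assms(3) by (intro card_UN_disjoint) auto
  ultimately show ?thesis by simp
qed

text \<open>A fibre has at most n points, and the deficits over S are part of the total 2 n - 2 over
  S and all critical values.\<close>

lemma card_preimage_bounds:
  assumes F: "rational_of_degree n F" and n: "n \<ge> 2" and S: "finite S"
  shows "card (F -` S) \<le> n * card S" "n * card S \<le> card (F -` S) + (2 * n - 2)"
proof -
  have n1: "n \<ge> 1" using n by simp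
  note le = rational_fibre(2)[OF F n1] and fin = finite_critical_values[OF F n1]
  have c: "card (F -` S) = (\<Sum>y\<in>S. card (F -` {y}))" by (rule card_preimage[OF F n1 S])
  show "card (F -` S) \<le> n * card S" unfolding c using sum_bounded_above[of S _ n] le by (simp add: mult.commute)
  have "n * card S - card (F -` S) = (\<Sum>y\<in>S. n - card (F -` {y}))"
    unfolding c using le by (simp add: sum_subtractf_nat mult.commute)
  also have "\<dots> \<le> (\<Sum>y\<in>S \<union> critical_values F. n - card (F -` {y}))"
    by (rule sum_mono2) (use S fin in auto)
  also have "\<dots> = 2 * n - 2" by (rule riemann_hurwitz[OF F n]) (use S fin in auto)
  finally show "n * card S \<le> card (F -` S) + (2 * n - 2)" by simp
qed

lemma rational_surj:
  assumes F: "rational_of_degree n F" and n: "n \<ge> 1"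
  shows "1 \<le> card (F -` {y})"
proof -
  obtain p q where lt: "lowest_terms n p q" and eq: "F = ratmap p q"
    using F by (auto simp: rational_of_degree_iff)
  obtain a b where y: "y = hpoint a b" and ab: "a \<noteq> 0 \<or> b \<noteq> 0" by (rule hpoint_cases)
  let ?G = "fibre_poly p q a b"
  have "F -` {y} \<noteq> {}"
  proof (cases "coeff ?G n = 0")
    case True
    then show ?thesis unfolding eq y fibre_eq[OF lt ab] by simp
  next
    case False
    then have "degree ?G \<ge> n" by (rule le_degree)
    then obtain z where "poly ?G z = 0" using n alg_closed_imp_poly_has_root[of ?G] by auto
    then show ?thesis unfolding eq y fibre_eq[OF lt ab] by auto
  qed
  then show ?thesis using rational_fibre(1)[OF F n] by (simp add: Suc_le_eq card_gt_0_iff)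
qed

text \<open>Each critical value has a deficit between 1 and n - 1, and the deficits sum to 2 n - 2.
  If there are only two critical values, both deficits are maximal.\<close>

lemma card_critical_values:
  assumes F: "rational_of_degree n F" and n: "n \<ge> 2"
  shows "card (critical_values F) \<le> 2 * n - 2" and "2 \<le> card (critical_values F)"
    and "card (critical_values F) = 2 \<Longrightarrow> y \<in> critical_values F \<Longrightarrow> card (F -` {y}) = 1"
proof -
  have n1: "n \<ge> 1" using n by simp
  let ?C = "critical_values F"
  have fin: "finite ?C" by (rule finite_critical_values[OF F n1])
  have RH: "(\<Sum>y\<in>?C. n - card (F -` {y})) = 2 * n - 2"
    by (rule riemann_hurwitz[OF F n fin]) simp
  have lo: "1 \<le> n - card (F -` {y})" if "y \<in> ?C" for y
    using that critical_values_iff[OF F n1] by (simp add: Suc_le_eq)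
  have hi: "n - card (F -` {y}) \<le> n - 1" for y using rational_surj[OF F n1, of y] by simp
  show "card ?C \<le> 2 * n - 2" using sum_mono[of ?C "\<lambda>_. 1" "\<lambda>y. n - card (F -` {y})"] lo RH by simp
  have "2 * n - 2 \<le> card ?C * (n - 1)"
    using sum_mono[of ?C "\<lambda>y. n - card (F -` {y})" "\<lambda>_. n - 1"] hi RH by simp
  then have "2 * (n - 1) \<le> card ?C * (n - 1)" by (simp add: diff_mult_distrib2)
  then show "2 \<le> card ?C" using n by (simp only: mult_le_cancel2)
  assume two: "card ?C = 2" and y: "y \<in> ?C"
  have "(\<Sum>y\<in>?C. n - card (F -` {y})) = (\<Sum>y\<in>?C. n - 1)" using RH two by simp
  then have "n - card (F -` {y}) = n - 1" using hi y fin by (rule sum_mono_inv)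
  then show "card (F -` {y}) = 1" using rational_surj[OF F n1, of y] rational_fibre(2)[OF F n1, of y] n by linarith
qed

section \<open>Maps commuting with an iterate\<close>

lemma funpow_vimage: "(F ^^ (i + j)) -` S = (F ^^ j) -` ((F ^^ i) -` S)"
  by (auto simp: funpow_add)

text \<open>If a pullback changes the size from c to c', then n c <= c' + 2 n - 2, that is, n (c -
  2) <= c' - 2. Iteration gives the claim, written without subtraction.\<close>

lemma card_funpow_preimage_lower:
  assumes F: "rational_of_degree n F" and n: "n \<ge> 2" and S: "finite S"
  shows "n ^ j * card S + 2 \<le> card ((F ^^ j) -` S) + 2 * n ^ j"
proof (induction j)
  case (Suc j)
  let ?S = "(F ^^ j) -` S"
  have "finite ?S" using finite_preimage[OF rational_of_degree_funpow[OF F]] n S by simp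
  moreover have "(F ^^ Suc j) -` S = F -` ?S" using funpow_vimage[where F = F and i = j and j = 1 and S = S] by simp
  ultimately have "n * card ?S \<le> card ((F ^^ Suc j) -` S) + (2 * n - 2)"
    using card_preimage_bounds(2)[OF F n] by simp
  moreover have "n * (n ^ j * card S + 2) \<le> n * (card ?S + 2 * n ^ j)"
    using Suc by (rule mult_le_mono2)
  ultimately show ?case using n unfolding power_Suc distrib_left mult.assoc mult.left_commute[of n 2] by linarith
qed simp

lemma Aut_infty_critical_values:
  assumes F: "rational_of_degree n F" and n: "n \<ge> 2" and \<nu>: "\<nu> \<in> Aut_infty F"
  shows "\<nu> ` critical_values F \<subseteq> critical_values (F ^^ 2)"
proof (rule subsetI, rule ccontr)
  fix y assume "y \<in> \<nu> ` critical_values F" and y: "y \<notin> critical_values (F ^^ 2)"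
  then obtain x where x: "x \<in> critical_values F" "y = \<nu> x" by blast
  have n1: "n \<ge> 1" using n by simp
  note F2 = rational_of_degree_funpow[OF F]
  have nk: "n ^ k \<ge> 1" for k using n by simp
  have fx: "card (F -` {x}) < n" using x(1) critical_values_iff[OF F n1] by simp
  have fy: "card ((F ^^ 2) -` {y}) = n ^ 2"
    using y critical_values_iff[OF F2 nk] rational_fibre(2)[OF F2 nk, of 2 y] by (meson le_neq_implies_less)
  obtain k0 where k0: "k0 \<ge> 1" "\<nu> \<in> Aut (F ^^ k0)" using \<nu> unfolding Aut_infty_def by auto
  \<comment> \<open>Doubling the exponent makes it at least 2, so that the second iterate can be
    split off.\<close>
  define k where "k = k0 * 2"
  have "\<nu> \<in> Aut (F ^^ k)" using Aut_iterate[OF k0(2), of 2] by (simp add: funpow_mult k_def mult.commute)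
  then have m: "bij \<nu>" and c: "\<And>x. (F ^^ k) (\<nu> x) = \<nu> ((F ^^ k) x)"
    using moebius_inverse by (auto simp: Aut_def fun_eq_iff)
  obtain j where k: "k = 2 + j" using k0(1) by (metis k_def le_Suc_ex mult_2_right mult_le_mono1 nat_mult_1)
  have "\<nu> ` ((F ^^ k) -` {x}) = (F ^^ k) -` {y}"
  proof
    show "(F ^^ k) -` {y} \<subseteq> \<nu> ` ((F ^^ k) -` {x})"
    proof
      fix w assume "w \<in> (F ^^ k) -` {y}"
      moreover obtain v where "w = \<nu> v" using m by (metis bij_pointE)
      ultimately have "w = \<nu> v" "\<nu> ((F ^^ k) v) = \<nu> x" using c x by auto
      then show "w \<in> \<nu> ` ((F ^^ k) -` {x})" using m by (simp add: bij_is_inj inj_eq)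
    qed
  qed (use c x in auto)
  then have eq: "card ((F ^^ k) -` {x}) = card ((F ^^ k) -` {y})"
    using m by (metis bij_is_inj card_image inj_on_subset subset_UNIV)
  \<comment> \<open>The loss of a point happens in the first pullback, and the remaining j + 1
    pullbacks multiply the size by at most n each.\<close>
  have "card ((F ^^ Suc j) -` (F -` {x})) \<le> n ^ Suc j * card (F -` {x})"
    using card_preimage_bounds(1)[OF F2[of "Suc j"] order_trans[OF n self_le_power]]
      rational_fibre(1)[OF F n1, of x] n1 by blast
  moreover have "(F ^^ k) -` {x} = (F ^^ Suc j) -` (F -` {x})"
    using funpow_vimage[where F = F and i = 1 and j = "Suc j" and S = "{x}"] k by simp
  moreover have "n ^ Suc j * card (F -` {x}) \<le> n ^ Suc j * (n - 1)"
    using fx by (intro mult_le_mono2) simp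
  ultimately have up: "card ((F ^^ k) -` {x}) \<le> n ^ Suc j * (n - 1)" by (metis order_trans)
  have "n ^ j * n ^ 2 + 2 \<le> card ((F ^^ k) -` {y}) + 2 * n ^ j"
    using card_funpow_preimage_lower[OF F n rational_fibre(1)[OF F2 nk, of 2 y], of j] fy
    unfolding k funpow_vimage[where F = F and i = 2 and j = j] by simp
  with up eq have "n ^ j * n ^ 2 + 2 \<le> n ^ Suc j * (n - 1) + 2 * n ^ j" by simp
  \<comment> \<open>The upper bound is n^(j+2) - n^(j+1), and 2 n^j <= n^(j+1) because n >= 2.
    Together they leave n^(j+2) + 2 <= n^(j+2).\<close>
  moreover have "n ^ Suc j * (n - 1) + n ^ j * n = n ^ j * n ^ 2"
    using n by (simp add: algebra_simps power2_eq_square diff_mult_distrib2)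
  moreover have "2 * n ^ j \<le> n ^ j * n" using n by simp
  ultimately show False by linarith
qed

section \<open>Moebius maps are determined by three values\<close>

text \<open>Finite fixed points of the quotient of the two maps are roots of c z^2 + (d - a) z - b,
  and fixing infinity forces c = 0. Three fixed points are too many unless this polynomial
  vanishes.\<close>

lemma moebius_eqI:
  assumes "moebius \<sigma>" "moebius \<tau>" and S: "card S = 3" "\<And>x. x \<in> S \<Longrightarrow> \<sigma> x = \<tau> x"
  shows "\<sigma> = \<tau>"
proof -
  have bij: "bij \<tau>" "moebius (inv \<tau>)" using moebius_inverse assms(2) by auto
  obtain a b c d where det: "a * d - b * c \<noteq> 0" and m: "inv \<tau> \<circ> \<sigma> = moebius_map a b c d"
    using moebius_comp[OF bij(2) assms(1)] moebius_def by auto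
  have fix1: "moebius_map a b c d x = x" if "x \<in> S" for x
    using S(2)[OF that] bij(1) by (simp add: m[symmetric] bij_is_inj)
  have root: "poly [:- b, d - a, c:] z = 0" if "Fin z \<in> S" for z
    using fix1[OF that] by (auto simp: hpoint_def field_simps split: if_splits)
  let ?Z = "{z. Fin z \<in> S}" and ?p = "[:- b, d - a, c:]"
  have S_eq: "S = Fin ` ?Z \<union> (S \<inter> {Infty})"
  proof (rule set_eqI)
    fix x show "x \<in> S \<longleftrightarrow> x \<in> Fin ` ?Z \<union> (S \<inter> {Infty})" by (cases x) auto
  qed
  have finS: "finite S" using S(1) card.infinite by fastforce
  have finZ: "finite ?Z" using finS by (intro finite_vimageI[of S Fin, unfolded vimage_def]) (auto simp: inj_on_def)
  have "card S = card (Fin ` ?Z) + card (S \<inter> {Infty})"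
    by (subst S_eq, subst card_Un_disjoint) (use finZ in auto)
  then have card: "3 = card ?Z + card (S \<inter> {Infty})" using S(1) by (simp add: card_image inj_on_def)
  have "?p = 0"
  proof (rule ccontr)
    assume p: "?p \<noteq> 0"
    have "card ?Z \<le> card {z. poly ?p z = 0}" using root poly_roots_finite[OF p] by (intro card_mono) auto
    then have le: "card ?Z \<le> degree ?p" using card_roots_rsquarefree(1)[OF p] by linarith
    show False
    proof (cases "Infty \<in> S")
      case True
      then have "c = 0" using fix1[OF True] by (auto simp: hpoint_def split: if_splits)
      then have "degree ?p \<le> 1" by simp
      then show False using le card True by simp
    next
      case False
      have "degree ?p \<le> 2" by (simp add: degree_pCons_eq_if)
      then show False using le card False by simp
    qed
  qed
  then have "b = 0" "c = 0" "d = a" by auto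
  then have "inv \<tau> \<circ> \<sigma> = id" using det m by (simp add: moebius_map_scalar)
  then have "inv \<tau> (\<sigma> x) = x" for x by (metis comp_apply id_apply)
  then have "\<sigma> x = \<tau> x" for x using bij(1) by (metis bij_inv_eq_iff)
  then show ?thesis by blast
qed

text \<open>The images of three chosen points of T embed M into the triples of points of C.\<close>

lemma card_moebius_le:
  assumes T: "card T \<ge> 3" and C: "finite C" and M: "\<And>\<nu>. \<nu> \<in> M \<Longrightarrow> moebius \<nu> \<and> \<nu> ` T \<subseteq> C"
  shows "finite M" and "card M \<le> card C ^ 3"
proof -
  obtain S where S: "S \<subseteq> T" "card S = 3" using T by (meson obtain_subset_with_card_n)
  then obtain u v w where uvw: "S = {u, v, w}" by (meson card_3_iff)
  let ?f = "\<lambda>\<nu>::cp1 \<Rightarrow> cp1. (\<nu> u, \<nu> v, \<nu> w)"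
  have inj: "inj_on ?f M"
    using M S(2) by (intro inj_onI moebius_eqI[of _ _ S]) (auto simp: uvw)
  have sub: "?f ` M \<subseteq> C \<times> C \<times> C" using M S(1) uvw by blast
  have fin: "finite (C \<times> C \<times> C)" using C by simp
  show "finite M" using inj sub fin by (meson finite_imageD finite_subset)
  have "card M \<le> card (C \<times> C \<times> C)" using inj sub fin by (rule card_inj_on_le)
  then show "card M \<le> card C ^ 3" by (simp add: power3_eq_cube card_cartesian_product mult.assoc)
qed

text \<open>This allows \<open>Aut_infty_critical_values\<close> to be applied to the second iterate
  in place of A.\<close>

lemma Aut_infty_funpow: "Aut_infty A \<subseteq> Aut_infty (A ^^ m)"
proof
  fix \<nu> assume "\<nu> \<in> Aut_infty A"
  then obtain k where k: "k \<ge> 1" "\<nu> \<in> Aut (A ^^ k)" unfolding Aut_infty_def by auto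
  have "\<nu> \<in> Aut ((A ^^ m) ^^ k)"
    using Aut_iterate[OF k(2), of m] by (simp add: funpow_mult mult.commute)
  then show "\<nu> \<in> Aut_infty (A ^^ m)" using k(1) unfolding Aut_infty_def by auto
qed

section \<open>Critical values of the second iterate\<close>

lemma poly_root_only_zero:
  fixes p :: "complex poly"
  assumes "\<And>z. poly p z = 0 \<longleftrightarrow> z = 0"
  obtains c where "c \<noteq> 0" "p = monom c (degree p)"
proof -
  have p0: "p \<noteq> 0" using assms[of 1] by auto
  have "{z. poly p z = 0} = {0}" using assms by auto
  then have "order 0 p = degree p" using sum_order_eq_degree[OF p0] by simp
  then have "monom 1 (degree p) dvd p" using p0 by (simp add: monom_1_dvd_iff)
  then obtain r where r: "p = monom 1 (degree p) * r" by (elim dvdE)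
  then have "r \<noteq> 0" using p0 by auto
  then have "degree p = degree p + degree r"
    by (metis r degree_mult_eq degree_monom_eq monom_eq_0_iff zero_neq_one)
  then obtain c where c: "r = [:c:]" by (metis add_cancel_right_right degree_eq_zeroE)
  then have "p = monom c (degree p)" using r by (simp add: smult_monom)
  then show ?thesis using that c \<open>r \<noteq> 0\<close> by auto
qed

text \<open>Conjugation in two stages: \<open>\<mu>\<close> places the special points and s then
  rescales the coordinate.\<close>

lemma moebius_conjugateI:
  assumes "moebius \<mu>" "moebius s" "s \<circ> (\<mu> \<circ> F \<circ> inv \<mu>) = G \<circ> s"
  shows "moebius_conjugate F G"
proof -
  let ?m = "s \<circ> \<mu>"
  have m: "moebius ?m" by (rule moebius_comp[OF assms(2,1)])
  have bij: "bij \<mu>" "bij ?m" using moebius_inverse assms(1) m by auto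
  have "F x = inv ?m (G (?m x))" for x
  proof -
    have "s (\<mu> (F (inv \<mu> (\<mu> x)))) = G (s (\<mu> x))" using assms(3) by (metis comp_apply)
    then have "?m (F x) = G (?m x)" using bij(1) by (simp add: bij_is_inj)
    then show ?thesis using bij(2) by (metis bij_inv_eq_iff)
  qed
  then have "F = inv ?m \<circ> G \<circ> ?m" unfolding comp_def by (rule ext)
  then show ?thesis unfolding moebius_conjugate_def using m by blast
qed

lemma moebius_scaling: "l \<noteq> 0 \<Longrightarrow> moebius (moebius_map l 0 0 1)"
  unfolding moebius_def by (intro exI[of _ l] exI[of _ 0] exI[of _ 1]) simp

lemma conjugate_power:
  assumes F: "rational_of_degree n F" and n: "n \<ge> 2" and "a \<noteq> b"
    and fa: "F -` {a} = {a}" and fb: "F -` {b} = {b}"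
  shows "moebius_conjugate F (ratmap (monom 1 n) 1)"
proof -
  obtain \<mu> where \<mu>: "moebius \<mu>" "\<mu> a = Infty" "\<mu> b = Fin 0"
    using moebius_two_points[OF \<open>a \<noteq> b\<close>] .
  define G where "G = \<mu> \<circ> F \<circ> inv \<mu>"
  have fib: "G -` {Infty} = {Infty}" "G -` {Fin 0} = {Fin 0}"
    using moebius_conj_fibre[OF \<mu>(1) \<mu>(1), of F a] moebius_conj_fibre[OF \<mu>(1) \<mu>(1), of F b]
    by (simp_all add: G_def \<mu> fa fb)
  obtain p q where lt: "lowest_terms n p q" and G: "G = ratmap p q"
    using moebius_conj_rational[OF F \<mu>(1) \<mu>(1)] by (auto simp: G_def rational_of_degree_iff)
  have "poly q z \<noteq> 0" for z
  proof
    assume "poly q z = 0"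
    then have "Fin z \<in> G -` {Infty}" by (simp add: G hpoint_def)
    then show False using fib by simp
  qed
  then have "degree q = 0" using alg_closed_imp_poly_has_root by blast
  then obtain d where q: "q = [:d:]" by (rule degree_eq_zeroE)
  have d: "d \<noteq> 0" using \<open>\<And>z. poly q z \<noteq> 0\<close> q by auto
  have "poly p z = 0 \<longleftrightarrow> Fin z \<in> G -` {Fin 0}" for z
    using d by (simp add: G q hpoint_def)
  then obtain c where c: "c \<noteq> 0" "p = monom c (degree p)"
    using poly_root_only_zero[of p] fib(2) by auto
  have p: "p = monom c n" using c lt q by (simp add: lowest_terms_def)
  \<comment> \<open>The map is now c z^n / d. Scaling by l turns it into z^n if l c z^n / d = (l
    z)^n, that is, l^(n-1) = c / d.\<close>
  obtain l where l: "l ^ (n - 1) = c / d" using nth_root_exists[of "n - 1" "c / d"] n by auto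
  have l0: "l \<noteq> 0" using l c d n by (auto simp: power_0_left)
  have ln: "l ^ n = l * (c / d)" using l n by (metis One_nat_def Suc_pred less_le_trans pos2 power_Suc)
  have "(moebius_map l 0 0 1 \<circ> G) x = (ratmap (monom 1 n) 1 \<circ> moebius_map l 0 0 1) x" for x
  proof (cases x)
    case (Fin z)
    have "l * (c * z ^ n / d) = l ^ n * z ^ n" by (simp add: ln)
    then show ?thesis using Fin d by (simp add: G p q hpoint_def poly_monom power_mult_distrib)
  next
    case Infty
    have "G Infty = Infty" using fib by auto
    then show ?thesis using Infty l0 n by (simp add: hpoint_def degree_monom_eq)
  qed
  then show ?thesis using moebius_conjugateI[OF \<mu>(1) moebius_scaling[OF l0]] by (metis G_def ext)
qed

lemma conjugate_inverse_power:
  assumes F: "rational_of_degree n F" and n: "n \<ge> 2" and "a \<noteq> b"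
    and fa: "F -` {a} = {b}" and fb: "F -` {b} = {a}"
  shows "moebius_conjugate F (ratmap 1 (monom 1 n))"
proof -
  obtain \<mu> where \<mu>: "moebius \<mu>" "\<mu> a = Infty" "\<mu> b = Fin 0"
    using moebius_two_points[OF \<open>a \<noteq> b\<close>] .
  define G where "G = \<mu> \<circ> F \<circ> inv \<mu>"
  have fib: "G -` {Infty} = {Fin 0}" "G -` {Fin 0} = {Infty}"
    using moebius_conj_fibre[OF \<mu>(1) \<mu>(1), of F a] moebius_conj_fibre[OF \<mu>(1) \<mu>(1), of F b]
    by (simp_all add: G_def \<mu> fa fb)
  obtain p q where lt: "lowest_terms n p q" and G: "G = ratmap p q"
    using moebius_conj_rational[OF F \<mu>(1) \<mu>(1)] by (auto simp: G_def rational_of_degree_iff)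
  have "poly p z \<noteq> 0" for z
  proof
    assume "poly p z = 0"
    then have "Fin z \<in> G -` {Fin 0}" using lowest_terms_root[OF lt, of z] by (simp add: G hpoint_def)
    then show False using fib by simp
  qed
  then have "degree p = 0" using alg_closed_imp_poly_has_root by blast
  then obtain c where p: "p = [:c:]" by (rule degree_eq_zeroE)
  have c: "c \<noteq> 0" using \<open>\<And>z. poly p z \<noteq> 0\<close> p by auto
  have "poly q z = 0 \<longleftrightarrow> Fin z \<in> G -` {Infty}" for z by (simp add: G hpoint_def)
  then obtain d where d: "d \<noteq> 0" "q = monom d (degree q)"
    using poly_root_only_zero[of q] fib(1) by auto
  have q: "q = monom d n" using d lt p by (simp add: lowest_terms_def)
  \<comment> \<open>The map is now c / (d z^n), and l c / (d z^n) = 1 / (l z)^n amounts to l^(n+1) =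
    d / c.\<close>
  obtain l where l: "l ^ (n + 1) = d / c" using nth_root_exists[of "n + 1" "d / c"] by auto
  have l0: "l \<noteq> 0" using l c d by auto
  have ln: "l ^ n * (l * c) = d" using l c by (simp add: field_simps)
  have "(moebius_map l 0 0 1 \<circ> G) x = (ratmap 1 (monom 1 n) \<circ> moebius_map l 0 0 1) x" for x
  proof (cases x)
    case (Fin z)
    have "l * (c / (d * z ^ n)) = 1 / (l ^ n * z ^ n)" using l0 c d by (simp add: ln[symmetric] field_simps)
    then show ?thesis using Fin c d(1) l0 n
      by (auto simp: G p q hpoint_def poly_monom power_mult_distrib)
  next
    case Infty
    have "G Infty = Fin 0" using fib by auto
    then show ?thesis using Infty l0 n by (simp add: hpoint_def degree_monom_eq)
  qed
  then show ?thesis using moebius_conjugateI[OF \<mu>(1) moebius_scaling[OF l0]] by (metis G_def ext)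
qed

lemma card_critical_values_iterate:
  assumes F: "rational_of_degree n F" and n: "n \<ge> 2"
    and nc: "\<not> moebius_conjugate F (ratmap (monom 1 n) 1)" "\<not> moebius_conjugate F (ratmap 1 (monom 1 n))"
  shows "3 \<le> card (critical_values (F ^^ 2))"
proof (rule ccontr)
  assume lt3: "\<not> ?thesis"
  let ?C = "critical_values F" and ?C2 = "critical_values (F ^^ 2)"
  have n1: "n \<ge> 1" using n by simp
  have F2: "rational_of_degree (n ^ 2) (F ^^ 2)" by (rule rational_of_degree_funpow[OF F])
  have n2: "n ^ 2 \<ge> 2" by (rule order_trans[OF n self_le_power]) (use n in auto)
  then have n21: "n ^ 2 \<ge> 1" by simp
  have two: "card ?C2 = 2" using lt3 card_critical_values(2)[OF F2 n2] by simp
  have pre: "(F ^^ 2) -` {y} = F -` (F -` {y})" for y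
    using funpow_vimage[where F = F and i = 1 and j = 1 and S = "{y}"] by (simp add: numeral_2_eq_2)
  have "?C \<subseteq> ?C2"
  proof
    fix y assume "y \<in> ?C"
    then have "n * card (F -` {y}) < n * n" using critical_values_iff[OF F n1] n by simp
    then have "card ((F ^^ 2) -` {y}) < n ^ 2"
      using card_preimage_bounds(1)[OF F n rational_fibre(1)[OF F n1, of y]]
      unfolding pre power2_eq_square by linarith
    then show "y \<in> ?C2" using critical_values_iff[OF F2 n21] by simp
  qed
  moreover have "finite ?C2" by (rule finite_critical_values[OF F2 n21])
  ultimately have eq: "?C = ?C2"
    using two card_critical_values(2)[OF F n] by (metis card_seteq)
  then obtain a b where ab: "?C = {a, b}" "a \<noteq> b" using two by (auto simp: card_2_iff)
  \<comment> \<open>A one-point fibre of the second iterate over y forces the only preimage u of y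
    to have a one-point fibre as well, so u is again critical.\<close>
  have single: "\<exists>u. F -` {y} = {u} \<and> u \<in> {a, b}" if "y \<in> {a, b}" for y
  proof -
    have "card (F -` {y}) = 1" "card ((F ^^ 2) -` {y}) = 1"
      using card_critical_values(3)[OF F n, of y] card_critical_values(3)[OF F2 n2, of y] that two eq ab
      by auto
    then obtain u where u: "F -` {y} = {u}" by (auto simp: card_1_singleton_iff)
    then have "card (F -` {u}) < n" using \<open>card ((F ^^ 2) -` {y}) = 1\<close> n by (simp add: pre)
    then show ?thesis using u critical_values_iff[OF F n1] ab by auto
  qed
  obtain u v where uv: "F -` {a} = {u}" "u \<in> {a, b}" "F -` {b} = {v}" "v \<in> {a, b}"
    using single[of a] single[of b] by (metis insertI1 insertI2)
  \<comment> \<open>Taking preimages is thus a permutation of the two points: the identity leads to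
    z^n, the swap to z^(-n).\<close>
  have "u \<noteq> v" using uv(1,3) ab(2) by auto
  then consider "u = a" "v = b" | "u = b" "v = a" using uv by auto
  then show False
    using conjugate_power[OF F n ab(2)] conjugate_inverse_power[OF F n ab(2)] uv nc by cases auto
qed

section \<open>Finiteness and the bound on the order\<close>

theorem theorem1p2:
  fixes n :: nat
  assumes "n \<ge> 2"
  shows "\<exists>N::nat. \<forall>A. rational_of_degree n A
      \<and> \<not> moebius_conjugate A (ratmap (monom 1 n) 1)
      \<and> \<not> moebius_conjugate A (ratmap 1 (monom 1 n)) \<longrightarrow>
    finite (Aut_infty A) \<and> card (Aut_infty A) \<le> N
      \<and> (\<forall>\<nu>\<in>Aut_infty A. \<nu> ` critical_values A \<subseteq> critical_values (A ^^ 2))"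
\<comment> \<open>The fourth iterate has degree n^4, hence at most 2 n^4 - 2 critical values, among
  which three images are chosen.\<close>
proof (intro exI[of _ "(2 * n ^ 4) ^ 3"] allI impI)
  fix A
  assume "rational_of_degree n A
      \<and> \<not> moebius_conjugate A (ratmap (monom 1 n) 1)
      \<and> \<not> moebius_conjugate A (ratmap 1 (monom 1 n))"
  then have A: "rational_of_degree n A"
    and nc: "\<not> moebius_conjugate A (ratmap (monom 1 n) 1)" "\<not> moebius_conjugate A (ratmap 1 (monom 1 n))"
    by auto
  \<comment> \<open>A itself may have only two critical values, too few to determine a Moebius map;
    its second iterate has at least three.\<close>
  define B where "B = A ^^ 2"
  have n2: "n ^ 2 \<ge> 2" by (rule order_trans[OF assms self_le_power]) (use assms in auto)
  have n4: "n ^ 4 \<ge> 2" by (rule order_trans[OF assms self_le_power]) (use assms in auto)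
  have B: "rational_of_degree (n ^ 2) B" unfolding B_def by (rule rational_of_degree_funpow[OF A])
  have B2: "rational_of_degree (n ^ 4) (B ^^ 2)" using rational_of_degree_funpow[OF B, of 2] by simp
  let ?C = "critical_values (B ^^ 2)"
  have three: "3 \<le> card (critical_values B)"
    unfolding B_def by (rule card_critical_values_iterate[OF A assms nc])
  have fin: "finite ?C" using finite_critical_values[OF B2] n4 by simp
  have M: "moebius \<nu> \<and> \<nu> ` critical_values B \<subseteq> ?C" if "\<nu> \<in> Aut_infty A" for \<nu>
  proof -
    have "\<nu> \<in> Aut_infty B" using that Aut_infty_funpow unfolding B_def by blast
    moreover have "moebius \<nu>" using that by (auto simp: Aut_infty_def Aut_def)
    ultimately show ?thesis using Aut_infty_critical_values[OF B n2] by blast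
  qed
  have "card (Aut_infty A) \<le> card ?C ^ 3" by (rule card_moebius_le(2)[OF three fin M])
  also have "\<dots> \<le> (2 * n ^ 4) ^ 3"
    using card_critical_values(1)[OF B2 n4] by (intro power_mono) auto
  finally show "finite (Aut_infty A) \<and> card (Aut_infty A) \<le> (2 * n ^ 4) ^ 3
      \<and> (\<forall>\<nu>\<in>Aut_infty A. \<nu> ` critical_values A \<subseteq> critical_values (A ^^ 2))"
    using card_moebius_le(1)[OF three fin M] Aut_infty_critical_values[OF A assms] by blast
qed

end
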